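(* Let $(A,\cdot,[,],\alpha)$ be a Hom-Leibniz Poisson algebra and $(V,\lambda^l,\lambda^r,\rho^l,\rho^r,\phi)$ a representation of it. A linear map $T:V\to A$ is a relative Rota-Baxter operator on $(A,\cdot,[,],\alpha)$ with respect to $(V,\lambda^l,\lambda^r,\rho^l,\rho^r,\phi)$ if and only if $$N_T:=\begin{pmatrix}0&T\\0&0\end{pmatrix}:A\oplus V\to A\oplus V,\qquad N_T(a+v)=Tv,$$ is a Nijenhuis operator on the (semi-direct product) Hom-Leibniz Poisson algebra $A\oplus V$.
   Context: All vector spaces are over a field $\mathbb K$ of characteristic $0$; $gl(V)$ is the space of linear endomorphisms of $V$, and juxtaposition of operators is composition. A Hom-associative algebra $(A,\cdot,\alpha)$ is a vector space $A$ with a bilinear product and a linear map $\alpha:A\to A$ such that $\alpha(x\cdot y)=\alpha(x)\cdot\alpha(y)$ and $(x\cdot y)\cdot\alpha(z)=\alpha(x)\cdot(y\cdot z)$. A (right) Hom-Leibniz algebra $(A,[,],\alpha)$ is a vector space with a bilinear bracket and a linear map $\alpha$ such that $\alpha([x,y])=[\alpha(x),\alpha(y)]$ and $[[x,y],\alpha(z)]=[\alpha(x),[y,z]]+[[x,z],\alpha(y)]$. A Hom-Leibniz Poisson algebra $(A,\cdot,[,],\alpha)$ is such that $(A,\cdot,\alpha)$ is Hom-associative, $(A,[,],\alpha)$ is Hom-Leibniz, and $[x\cdot y,\alpha(z)]=\alpha(x)\cdot[y,z]+[x,z]\cdot\alpha(y)$ for all $x,y,z\in A$. A Nijenhuis operator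 on a Hom-Leibniz Poisson algebra $(B,\cdot,[,],\beta)$ is a linear map $N:B\to B$ with $N\beta=\beta N$, $N(x)\cdot N(y)=N(N(x)\cdot y+x\cdot N(y)-N(x\cdot y))$ and $[N(x),N(y)]=N([N(x),y]+[x,N(y)]-N([x,y]))$ for all $x,y\in B$. A representation of a Hom-associative algebra $(A,\cdot,\alpha)$ is $(V,\lambda^l,\lambda^r,\phi)$ with $V$ a vector space, $\phi\in gl(V)$, and $\lambda^l,\lambda^r:A\to gl(V)$ linear such that for all $x,y\in A$: $\phi\lambda^l(x)=\lambda^l(\alpha(x))\phi$; $\phi\lambda^r(x)=\lambda^r(\alpha(x))\phi$; $\lambda^l(x\cdot y)\phi=\lambda^l(\alpha(x))\lambda^l(y)$; $\lambda^r(x\cdot y)\phi=\lambda^r(\alpha(y))\lambda^r(x)$; $\lambda^l(\alpha(x))\lambda^r(y)=\lambda^r(\alpha(y))\lambda^l(x)$. A representation of a Hom-Leibniz algebra $(A,[,],\alpha)$ is $(V,\rho^l,\rho^r,\phi)$ with $\phi\in gl(V)$ and $\rho^l,\rho^r:A\to gl(V)$ linear such that for all $x,y\in A$: $\rho^l(\alpha(x))\phi=\phi\rho^l(x)$; $\rho^r(\alpha(x))\phi=\phi\rho^r(x)$; $\rho^l([x,y])\phi=\rho^l(\alpha(x))\rho^l(y)+\rho^r(\alpha(y))\rho^l(x)$; $\rho^r(\alpha(y))\rho^l(x)=\rho^l(\alpha(x))\rho^r(y)+\rho^l([x,y])\phi$; $\rho^r(\alpha(y))\rho^r(x)=\rho^r([x,y])\phi+\rho^r(\alpha(x))\rho^r(y)$.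 A representation of a Hom-Leibniz Poisson algebra $(A,\cdot,[,],\alpha)$ is $(V,\lambda^l,\lambda^r,\rho^l,\rho^r,\phi)$ such that $(V,\lambda^l,\lambda^r,\phi)$ is a representation of $(A,\cdot,\alpha)$, $(V,\rho^l,\rho^r,\phi)$ is a representation of $(A,[,],\alpha)$, and for all $x,y\in A$: $\rho^r(\alpha(y))\lambda^l(x)=\lambda^l(\alpha(x))\rho^r(y)+\lambda^l([x,y])\phi$; $\rho^r(\alpha(y))\lambda^r(x)=\lambda^r([x,y])\phi+\lambda^r(\alpha(x))\rho^r(y)$; $\rho^l(x\cdot y)\phi=\lambda^l(\alpha(x))\rho^l(y)+\lambda^r(\alpha(y))\rho^l(x)$. The semi-direct product is the Hom-Leibniz Poisson algebra $(A\oplus V,\ast,\{,\},\alpha\oplus\phi)$ with $(x+u)\ast(y+v)=x\cdot y+\lambda^l(x)v+\lambda^r(y)u$, $\{x+u,y+v\}=[x,y]+\rho^l(x)v+\rho^r(y)u$, $(\alpha\oplus\phi)(x+u)=\alpha(x)+\phi(u)$. A relative Rota-Baxter operator on $(A,\cdot,[,],\alpha)$ with respect to $(V,\lambda^l,\lambda^r,\rho^l,\rho^r,\phi)$ is a linear map $T:V\to A$ with $T\phi=\alpha T$, $Tu\cdot Tv=T(\lambda^l(Tu)v+\lambda^r(Tv)u)$ and $[Tu,Tv]=T(\rho^l(Tu)v+\rho^r(Tv)u)$ for all $u,v\in V$. *)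

theory Defs
  imports "HOL-Analysis.Product_Vector"
begin

text \<open>
  A vector space over a field of characteristic 0 is a type of class \<^class>\<open>ab_group_add\<close> with a
  scalar multiplication satisfying the library locale \<^locale>\<open>vector_space\<close>. A linear map
  \<open>l : A \<rightarrow> gl(V)\<close> is given in uncurried form, as a map \<open>l x v\<close> that is linear in each argument:
  linearity in \<open>v\<close> says \<open>l x \<in> gl(V)\<close>, and linearity in \<open>x\<close> is linearity into \<open>gl(V)\<close> with its
  pointwise operations. Identities between operators are stated pointwise.
\<close>

definition bilinear_map ::
  "('k::field \<Rightarrow> 'a::ab_group_add \<Rightarrow> 'a) \<Rightarrow> ('k \<Rightarrow> 'b::ab_group_add \<Rightarrow> 'b) \<Rightarrow>
   ('k \<Rightarrow> 'c::ab_group_add \<Rightarrow> 'c) \<Rightarrow> ('a \<Rightarrow> 'b \<Rightarrow> 'c) \<Rightarrow> bool" where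
  "bilinear_map s1 s2 s3 f \<longleftrightarrow>
     (\<forall>x. Vector_Spaces.linear s2 s3 (f x)) \<and> (\<forall>y. Vector_Spaces.linear s1 s3 (\<lambda>x. f x y))"


subsection \<open>Algebras\<close>

locale hom_associative_algebra = vector_space scale
  for scale :: "'k::field_char_0 \<Rightarrow> 'a::ab_group_add \<Rightarrow> 'a" +
  fixes mul :: "'a \<Rightarrow> 'a \<Rightarrow> 'a"  (infixl \<open>\<cdot>\<close> 70)
    and \<alpha> :: "'a \<Rightarrow> 'a"
  assumes mul_bilinear: "bilinear_map scale scale scale mul"
    and mul_twist_linear: "Vector_Spaces.linear scale scale \<alpha>"
    and mul_multiplicative: "\<alpha> (x \<cdot> y) = \<alpha> x \<cdot> \<alpha> y"
    and hom_associative: "(x \<cdot> y) \<cdot> \<alpha> z = \<alpha> x \<cdot> (y \<cdot> z)"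

locale hom_leibniz_algebra = vector_space scale
  for scale :: "'k::field_char_0 \<Rightarrow> 'a::ab_group_add \<Rightarrow> 'a" +
  fixes br :: "'a \<Rightarrow> 'a \<Rightarrow> 'a"
    and \<alpha> :: "'a \<Rightarrow> 'a"
  assumes br_bilinear: "bilinear_map scale scale scale br"
    and br_twist_linear: "Vector_Spaces.linear scale scale \<alpha>"
    and br_multiplicative: "\<alpha> (br x y) = br (\<alpha> x) (\<alpha> y)"
    and hom_leibniz: "br (br x y) (\<alpha> z) = br (\<alpha> x) (br y z) + br (br x z) (\<alpha> y)"

locale hom_leibniz_poisson_algebra =
  hom_associative_algebra scale mul \<alpha> + hom_leibniz_algebra scale br \<alpha>
  for scale :: "'k::field_char_0 \<Rightarrow> 'a::ab_group_add \<Rightarrow> 'a"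
    and mul :: "'a \<Rightarrow> 'a \<Rightarrow> 'a"  (infixl \<open>\<cdot>\<close> 70)
    and br :: "'a \<Rightarrow> 'a \<Rightarrow> 'a"
    and \<alpha> :: "'a \<Rightarrow> 'a" +
  assumes hom_poisson: "br (x \<cdot> y) (\<alpha> z) = \<alpha> x \<cdot> br y z + br x z \<cdot> \<alpha> y"

locale nijenhuis_operator = hom_leibniz_poisson_algebra scale mul br \<beta>
  for scale :: "'k::field_char_0 \<Rightarrow> 'a::ab_group_add \<Rightarrow> 'a"
    and mul :: "'a \<Rightarrow> 'a \<Rightarrow> 'a"  (infixl \<open>\<cdot>\<close> 70)
    and br :: "'a \<Rightarrow> 'a \<Rightarrow> 'a"
    and \<beta> :: "'a \<Rightarrow> 'a" +
  fixes N :: "'a \<Rightarrow> 'a"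
  assumes nijenhuis_linear: "Vector_Spaces.linear scale scale N"
    and nijenhuis_commute: "N (\<beta> x) = \<beta> (N x)"
    and nijenhuis_mul: "N x \<cdot> N y = N (N x \<cdot> y + x \<cdot> N y - N (x \<cdot> y))"
    and nijenhuis_br: "br (N x) (N y) = N (br (N x) y + br x (N y) - N (br x y))"


subsection \<open>Representations\<close>

locale hom_associative_representation =
  A: hom_associative_algebra scaleA mul \<alpha> + V: vector_space scaleV
  for scaleA :: "'k::field_char_0 \<Rightarrow> 'a::ab_group_add \<Rightarrow> 'a"
    and mul :: "'a \<Rightarrow> 'a \<Rightarrow> 'a"  (infixl \<open>\<cdot>\<close> 70)
    and \<alpha> :: "'a \<Rightarrow> 'a"
    and scaleV :: "'k \<Rightarrow> 'v::ab_group_add \<Rightarrow> 'v" +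
  fixes ll lr :: "'a \<Rightarrow> 'v \<Rightarrow> 'v"
    and \<phi> :: "'v \<Rightarrow> 'v"
  assumes ll_bilinear: "bilinear_map scaleA scaleV scaleV ll"
    and lr_bilinear: "bilinear_map scaleA scaleV scaleV lr"
    and l_twist_linear: "Vector_Spaces.linear scaleV scaleV \<phi>"
    and twist_ll: "\<phi> (ll x v) = ll (\<alpha> x) (\<phi> v)"
    and twist_lr: "\<phi> (lr x v) = lr (\<alpha> x) (\<phi> v)"
    and ll_mul: "ll (x \<cdot> y) (\<phi> v) = ll (\<alpha> x) (ll y v)"
    and lr_mul: "lr (x \<cdot> y) (\<phi> v) = lr (\<alpha> y) (lr x v)"
    and ll_lr: "ll (\<alpha> x) (lr y v) = lr (\<alpha> y) (ll x v)"

locale hom_leibniz_representation =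
  A: hom_leibniz_algebra scaleA br \<alpha> + V: vector_space scaleV
  for scaleA :: "'k::field_char_0 \<Rightarrow> 'a::ab_group_add \<Rightarrow> 'a"
    and br :: "'a \<Rightarrow> 'a \<Rightarrow> 'a"
    and \<alpha> :: "'a \<Rightarrow> 'a"
    and scaleV :: "'k \<Rightarrow> 'v::ab_group_add \<Rightarrow> 'v" +
  fixes rl rr :: "'a \<Rightarrow> 'v \<Rightarrow> 'v"
    and \<phi> :: "'v \<Rightarrow> 'v"
  assumes rl_bilinear: "bilinear_map scaleA scaleV scaleV rl"
    and rr_bilinear: "bilinear_map scaleA scaleV scaleV rr"
    and r_twist_linear: "Vector_Spaces.linear scaleV scaleV \<phi>"
    and twist_rl: "rl (\<alpha> x) (\<phi> v) = \<phi> (rl x v)"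
    and twist_rr: "rr (\<alpha> x) (\<phi> v) = \<phi> (rr x v)"
    and rl_br: "rl (br x y) (\<phi> v) = rl (\<alpha> x) (rl y v) + rr (\<alpha> y) (rl x v)"
    and rr_rl: "rr (\<alpha> y) (rl x v) = rl (\<alpha> x) (rr y v) + rl (br x y) (\<phi> v)"
    and rr_rr: "rr (\<alpha> y) (rr x v) = rr (br x y) (\<phi> v) + rr (\<alpha> x) (rr y v)"

locale hom_leibniz_poisson_representation =
  A: hom_leibniz_poisson_algebra scaleA mul br \<alpha> +
  hom_associative_representation scaleA mul \<alpha> scaleV ll lr \<phi> +
  hom_leibniz_representation scaleA br \<alpha> scaleV rl rr \<phi>
  for scaleA :: "'k::field_char_0 \<Rightarrow> 'a::ab_group_add \<Rightarrow> 'a"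
    and mul :: "'a \<Rightarrow> 'a \<Rightarrow> 'a"  (infixl \<open>\<cdot>\<close> 70)
    and br :: "'a \<Rightarrow> 'a \<Rightarrow> 'a"
    and \<alpha> :: "'a \<Rightarrow> 'a"
    and scaleV :: "'k \<Rightarrow> 'v::ab_group_add \<Rightarrow> 'v"
    and ll lr rl rr :: "'a \<Rightarrow> 'v \<Rightarrow> 'v"
    and \<phi> :: "'v \<Rightarrow> 'v" +
  assumes rr_ll: "rr (\<alpha> y) (ll x v) = ll (\<alpha> x) (rr y v) + ll (br x y) (\<phi> v)"
    and rr_lr: "rr (\<alpha> y) (lr x v) = lr (br x y) (\<phi> v) + lr (\<alpha> x) (rr y v)"
    and rl_mul: "rl (x \<cdot> y) (\<phi> v) = ll (\<alpha> x) (rl y v) + lr (\<alpha> y) (rl x v)"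

locale relative_rota_baxter_operator =
  hom_leibniz_poisson_representation scaleA mul br \<alpha> scaleV ll lr rl rr \<phi>
  for scaleA :: "'k::field_char_0 \<Rightarrow> 'a::ab_group_add \<Rightarrow> 'a"
    and mul :: "'a \<Rightarrow> 'a \<Rightarrow> 'a"  (infixl \<open>\<cdot>\<close> 70)
    and br :: "'a \<Rightarrow> 'a \<Rightarrow> 'a"
    and \<alpha> :: "'a \<Rightarrow> 'a"
    and scaleV :: "'k \<Rightarrow> 'v::ab_group_add \<Rightarrow> 'v"
    and ll lr rl rr :: "'a \<Rightarrow> 'v \<Rightarrow> 'v"
    and \<phi> :: "'v \<Rightarrow> 'v" +
  fixes T :: "'v \<Rightarrow> 'a"
  assumes rota_baxter_linear: "Vector_Spaces.linear scaleV scaleA T"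
    and rota_baxter_commute: "T (\<phi> u) = \<alpha> (T u)"
    and rota_baxter_mul: "T u \<cdot> T v = T (ll (T u) v + lr (T v) u)"
    and rota_baxter_br: "br (T u) (T v) = T (rl (T u) v + rr (T v) u)"


subsection \<open>Semi-direct product\<close>

text \<open>
  The direct sum \<open>A \<oplus> V\<close> is the product type, \<open>x + u\<close> being the pair \<open>(x, u)\<close>, with the library
  scalar multiplication \<^const>\<open>module_prod.scale\<close>; the twisting map \<open>\<alpha> \<oplus> \<phi>\<close> is \<open>map_prod \<alpha> \<phi>\<close>.
  Both operations \<open>\<ast>\<close> and \<open>{,}\<close> of the semi-direct product have the form below, for the data
  \<open>(\<cdot>, ll, lr)\<close> and \<open>([,], rl, rr)\<close> respectively.
\<close>

definition semidirect ::
  "('a \<Rightarrow> 'a \<Rightarrow> 'a) \<Rightarrow> ('a \<Rightarrow> 'v \<Rightarrow> 'v) \<Rightarrow> ('a \<Rightarrow> 'v \<Rightarrow> 'v) \<Rightarrow>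
   'a \<times> 'v \<Rightarrow> 'a \<times> 'v \<Rightarrow> 'a \<times> ('v::ab_group_add)" where
  "semidirect m l r = (\<lambda>(x, u) (y, v). (m x y, l x v + r y u))"

definition N_op :: "('v \<Rightarrow> 'a) \<Rightarrow> 'a \<times> 'v \<Rightarrow> 'a \<times> ('v::ab_group_add)" where
  "N_op T = (\<lambda>(a, v). (T v, 0))"

end

theory Submission
  imports Defs
begin

text \<open>
  The \<open>A\<close>-components of \<open>N_op T (x, u) \<ast> (y, v)\<close>, \<open>(x, u) \<ast> N_op T (y, v)\<close> and
  \<open>N_op T ((x, u) \<ast> (y, v))\<close> are discarded by \<open>N_op T\<close>; their \<open>V\<close>-components are
  \<open>ll (T u) v\<close>, \<open>lr (T v) u\<close> and \<open>0\<close>. So each Nijenhuis identity for \<open>N_op T\<close> is the Rota-Baxter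
  identity for \<open>T\<close>, independently of \<open>x\<close> and \<open>y\<close>.
\<close>

lemma bilinear_map_simps:
  assumes "bilinear_map s1 s2 s3 f"
  shows "f (x + x') y = f x y + f x' y" "f x (y + y') = f x y + f x y'"
    and "f (s1 c x) y = s3 c (f x y)" "f x (s2 c y) = s3 c (f x y)"
    and "f x 0 = 0" "f 0 y = 0"
proof -
  have l: "module_hom s2 s3 (f x)" and r: "module_hom s1 s3 (\<lambda>x. f x y)" for x y
    using assms by (simp_all add: bilinear_map_def module_hom_iff_linear)
  show "f (x + x') y = f x y + f x' y" "f (s1 c x) y = s3 c (f x y)" "f 0 y = 0"
    using module_hom.add[OF r] module_hom.scale[OF r] module_hom.zero[OF r] by auto
  show "f x (y + y') = f x y + f x y'" "f x (s2 c y) = s3 c (f x y)" "f x 0 = 0"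
    using module_hom.add[OF l] module_hom.scale[OF l] module_hom.zero[OF l] by auto
qed

lemma vector_space_prod_scale:
  assumes "vector_space s1" "vector_space s2"
  shows "vector_space (module_prod.scale s1 s2)"
proof -
  interpret vector_space_prod s1 s2
    using assms by (simp add: vector_space_prod_def vector_space_pair_def)
  show ?thesis by (rule p.vector_space_axioms)
qed

text \<open>\<open>module_prod.scale\<close> is a locale constant, so its defining equation holds
  only once both factors are known to be modules.\<close>

lemma prod_scale_Pair:
  assumes "vector_space s1" "vector_space s2"
  shows "module_prod.scale s1 s2 c (x, u) = (s1 c x, s2 c u)"
proof -
  interpret module_prod s1 s2
    using assms by (simp add: module_prod_def module_pair_def module_iff_vector_space)
  show ?thesis by (simp add: scale_def)
qed

lemma semidirect_Pair [simp]: "semidirect m l r (x, u) (y, v) = (m x y, l x v + r y u)"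
  by (simp add: semidirect_def)

lemma N_op_Pair [simp]: "N_op T (a, v) = (T v, 0)"
  by (simp add: N_op_def)

lemma bilinear_map_semidirect:
  assumes m: "bilinear_map s s s m" and l: "bilinear_map s t t l" and r: "bilinear_map s t t r"
  defines "p \<equiv> module_prod.scale s t"
  shows "bilinear_map p p p (semidirect m l r)"
proof -
  \<comment> \<open>Linearity of a map includes that its domain and codomain are vector spaces;
    \<open>l\<close> has \<open>s\<close> and \<open>t\<close> among them.\<close>
  have A: "vector_space s" and V: "vector_space t"
    using l by (simp_all add: bilinear_map_def Vector_Spaces.linear_iff)
  interpret V: vector_space t by (rule V)
  show ?thesis
    by (auto simp: bilinear_map_def p_def Vector_Spaces.linear_iff vector_space_prod_scale A V
        prod_scale_Pair bilinear_map_simps[OF m] bilinear_map_simps[OF l]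
        bilinear_map_simps[OF r] V.scale_right_distrib add_ac)
qed

lemma linear_map_prod:
  assumes "Vector_Spaces.linear s s f" "Vector_Spaces.linear t t g"
  defines "p \<equiv> module_prod.scale s t"
  shows "Vector_Spaces.linear p p (map_prod f g)"
  using assms by (auto simp: Vector_Spaces.linear_iff vector_space_prod_scale prod_scale_Pair)

lemma linear_N_op:
  assumes T: "Vector_Spaces.linear t s T"
  defines "p \<equiv> module_prod.scale s t"
  shows "Vector_Spaces.linear p p (N_op T)"
proof -
  interpret T: Vector_Spaces.linear t s T by (rule T)
  show ?thesis
    using T by (auto simp: p_def Vector_Spaces.linear_iff vector_space_prod_scale prod_scale_Pair)
qed

context hom_leibniz_poisson_representation
begin

lemmas bilinear_simps =
  bilinear_map_simps[OF ll_bilinear] bilinear_map_simps[OF lr_bilinear]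
  bilinear_map_simps[OF rl_bilinear] bilinear_map_simps[OF rr_bilinear]

lemma twist_add: "\<phi> (u + v) = \<phi> u + \<phi> v"
  using l_twist_linear by (simp add: Vector_Spaces.linear_iff)

text \<open>A Nijenhuis operator presupposes an algebra, so this one has to be built. The
  \<open>A\<close>-components of the identities are those of \<open>A\<close>. The
  \<open>V\<close>-components are additive in the \<open>V\<close>-arguments, and each argument
  accounts for one representation axiom.\<close>

lemma hom_leibniz_poisson_semidirect:
  "hom_leibniz_poisson_algebra (module_prod.scale scaleA scaleV)
     (semidirect mul ll lr) (semidirect br rl rr) (map_prod \<alpha> \<phi>)"
  (is "hom_leibniz_poisson_algebra ?s ?m ?b ?t")
proof -
  interpret P: vector_space ?s
    by (rule vector_space_prod_scale) unfold_locales
  have t: "Vector_Spaces.linear ?s ?s ?t"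
    by (rule linear_map_prod[OF A.mul_twist_linear l_twist_linear])
  have m: "bilinear_map ?s ?s ?s ?m"
    by (rule bilinear_map_semidirect[OF A.mul_bilinear ll_bilinear lr_bilinear])
  have b: "bilinear_map ?s ?s ?s ?b"
    by (rule bilinear_map_semidirect[OF A.br_bilinear rl_bilinear rr_bilinear])
  show ?thesis
  proof (intro hom_leibniz_poisson_algebra.intro hom_associative_algebra.intro
      hom_associative_algebra_axioms.intro hom_leibniz_algebra.intro
      hom_leibniz_algebra_axioms.intro hom_leibniz_poisson_algebra_axioms.intro
      P.vector_space_axioms m b t, goal_cases)
    case (1 x y)
    show ?case
      by (cases x; cases y)
        (simp add: A.mul_multiplicative twist_add twist_ll twist_lr)
  next
    case (2 x y z)
    show ?case
      by (cases x; cases y; cases z)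
        \<comment> \<open>The \<open>V\<close>-parts of \<open>x\<close>, \<open>y\<close>,
          \<open>z\<close> use \<open>lr_mul\<close>, \<open>ll_lr\<close>, \<open>ll_mul\<close>
          respectively.\<close>
        (simp add: A.hom_associative bilinear_simps ll_mul lr_mul ll_lr add_ac)
  next
    case (3 x y)
    show ?case
      by (cases x; cases y)
        (simp add: A.br_multiplicative twist_add twist_rl twist_rr)
  next
    case (4 x y z)
    obtain a u b v c w where "x = (a, u)" "y = (b, v)" "z = (c, w)"
      by (metis surj_pair)
    then show ?case
      \<comment> \<open>without the instantiations these rules rewrite in circles\<close>
      by (simp add: A.hom_leibniz[of a b c] bilinear_simps rl_br[of a b w] rr_rl[of c a v] rr_rr[of c b u] add_ac)
  next
    case (5 x y z)
    obtain a u b v c w where "x = (a, u)" "y = (b, v)" "z = (c, w)"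
      by (metis surj_pair)
    then show ?case
      \<comment> \<open>Here the three \<open>V\<close>-parts use \<open>rr_lr\<close>,
        \<open>rr_ll\<close>, \<open>rl_mul\<close>, in the same order.\<close>
      by (simp add: A.hom_poisson bilinear_simps rl_mul rr_ll rr_lr add_ac)
  qed
qed

end

theorem proposition4p15:
  fixes scaleA :: "'k::field_char_0 \<Rightarrow> 'a::ab_group_add \<Rightarrow> 'a"
    and mul br :: "'a \<Rightarrow> 'a \<Rightarrow> 'a"
    and \<alpha> :: "'a \<Rightarrow> 'a"
    and scaleV :: "'k \<Rightarrow> 'v::ab_group_add \<Rightarrow> 'v"
    and ll lr rl rr :: "'a \<Rightarrow> 'v \<Rightarrow> 'v"
    and \<phi> :: "'v \<Rightarrow> 'v"
    and T :: "'v \<Rightarrow> 'a"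
  assumes "hom_leibniz_poisson_algebra scaleA mul br \<alpha>"
    and "hom_leibniz_poisson_representation scaleA mul br \<alpha> scaleV ll lr rl rr \<phi>"
    and "Vector_Spaces.linear scaleV scaleA T"
  shows "relative_rota_baxter_operator scaleA mul br \<alpha> scaleV ll lr rl rr \<phi> T \<longleftrightarrow>
    nijenhuis_operator (module_prod.scale scaleA scaleV)
      (semidirect mul ll lr) (semidirect br rl rr) (map_prod \<alpha> \<phi>) (N_op T)"
proof -
  interpret hom_leibniz_poisson_representation scaleA mul br \<alpha> scaleV ll lr rl rr \<phi>
    by (rule assms(2))
  \<comment> \<open>Applying the twist after \<open>N_op T\<close> gives
    \<open>(\<alpha> (T v), \<phi> 0)\<close>, so this turns commutation of \<open>N_op T\<close>
    with the twist into \<open>T (\<phi> v) = \<alpha> (T v)\<close>.\<close>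
  have \<phi>0: "\<phi> 0 = 0"
    using twist_add[of 0 0] by simp
  show ?thesis
    unfolding relative_rota_baxter_operator_def relative_rota_baxter_operator_axioms_def
      nijenhuis_operator_def nijenhuis_operator_axioms_def
    \<comment> \<open>These facts settle the structural and linearity conjuncts on both sides. Only
      the three identities remain, and after splitting pairs the quantifiers over
      \<open>A\<close>-components are vacuous.\<close>
    using assms(2,3) hom_leibniz_poisson_semidirect linear_N_op[OF assms(3)]
    by (simp add: split_paired_all bilinear_simps \<phi>0)
qed

end
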